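(* Let $0 \le c < 1/2$ and let $(p_n)_{n\ge 1}$ be a sequence in $[0,1]$ with $p_n = \Omega(n^{-c})$. For each $n$, let $G_n$ be a random graph drawn from the Erdős–Rényi distribution $G(n,p_n)$. Then for all $\epsilon>0$ and $\delta>0$ there exists $N$ such that for all $n \ge N$, $$P[\mathrm{GAPCW}(G_n) < 1+\delta] > 1-\epsilon.$$
   Context: $p_n=\Omega(n^{-c})$ means there exist $k>0$ and $n_0$ with $p_n \ge k n^{-c}$ for all $n\ge n_0$. The distribution $G(n,p)$ on graphs with vertex set of size $n$ includes each of the $\binom{n}{2}$ possible edges independently with probability $p$. For an undirected graph $G=(V,E)$ with $|V|=n$, a layout is a bijection $\phi:V\to\{1,\dots,n\}$. For $1\le i\le n$, $\theta(i,\phi,G)$ is the number of edges $uv\in E$ with $\phi(u)\le i<\phi(v)$. Define $\mathrm{CW}(G,\phi)=\max_{1\le i\le n}\theta(i,\phi,G)$, $\mathrm{MINCW}(G)=\min_\phi \mathrm{CW}(G,\phi)$, $\mathrm{MAXCW}(G)=\max_\phi\mathrm{CW}(G,\phi)$ (over all layouts $\phi$), and $\mathrm{GAPCW}(G)=\mathrm{MAXCW}(G)/\mathrm{MINCW}(G)$. *)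

theory Defs
  imports "HOL-Probability.Probability" "HOL-Probability.Product_PMF" "HOL-Library.Landau_Symbols"
begin

type_synonym 'a ugraph = "'a set \<times> 'a set set"

abbreviation verts :: "'a ugraph \<Rightarrow> 'a set" where "verts \<equiv> fst"

abbreviation edges :: "'a ugraph \<Rightarrow> 'a set set" where "edges \<equiv> snd"

text \<open>Layouts are taken extensional, so that there are exactly \<open>n!\<close> of them
  and the extrema over all layouts below range over finite sets.\<close>

definition layouts :: "'a ugraph \<Rightarrow> ('a \<Rightarrow> nat) set" where
  "layouts G = {\<phi> \<in> extensional (verts G). bij_betw \<phi> (verts G) {1..card (verts G)}}"

definition theta :: "nat \<Rightarrow> ('a \<Rightarrow> nat) \<Rightarrow> 'a ugraph \<Rightarrow> nat" where
  "theta i \<phi> G = card {e \<in> edges G. \<exists>u v. e = {u, v} \<and> \<phi> u \<le> i \<and> i < \<phi> v}"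

definition CW :: "'a ugraph \<Rightarrow> ('a \<Rightarrow> nat) \<Rightarrow> nat" where
  "CW G \<phi> = Max ((\<lambda>i. theta i \<phi> G) ` {1..card (verts G)})"

definition MINCW :: "'a ugraph \<Rightarrow> nat" where
  "MINCW G = Min (CW G ` layouts G)"

definition MAXCW :: "'a ugraph \<Rightarrow> nat" where
  "MAXCW G = Max (CW G ` layouts G)"

text \<open>The ratio is meaningful only if \<open>MINCW G \<noteq> 0\<close>, i.e. if \<open>G\<close> has an edge;
  otherwise division by zero gives the value 0.\<close>

definition GAPCW :: "'a ugraph \<Rightarrow> real" where
  "GAPCW G = real (MAXCW G) / real (MINCW G)"

definition erdos_renyi :: "nat \<Rightarrow> real \<Rightarrow> nat ugraph pmf" where
  "erdos_renyi n p =
     (let K = {e. e \<subseteq> {1..n} \<and> card e = 2}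
      in map_pmf (\<lambda>b. ({1..n}, {e \<in> K. b e})) (Pi_pmf K False (\<lambda>_. bernoulli_pmf p)))"

end

theory Submission
  imports Defs "HOL-Probability.Hoeffding" "HOL-Real_Asymp.Real_Asymp"
begin

text \<open>Along any layout, the edges counted by \<open>theta i\<close> are those of the cut determined by the
  first \<open>i\<close> vertices. A cut with sides of sizes \<open>s\<close> and \<open>n - s\<close> has binomially many edges with mean
  \<open>p s (n - s)\<close>, and by Hoeffding's inequality it deviates from the mean by \<open>\<eta> p n\<^sup>2\<close> with probability
  at most \<open>2 exp (- 8 \<eta>\<^sup>2 p\<^sup>2 n\<^sup>2)\<close>. Since \<open>p\<^sup>2 n\<^sup>2\<close> is at least of order \<open>n powr (2 - 2 * c)\<close>, which
  dominates \<open>n\<close> for \<open>c < 1/2\<close>, a union bound over all \<open>2 ^ n\<close> cuts shows that with high probability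
  no cut deviates this much. Then every cut has fewer than \<open>(1/4 + \<eta>) p n\<^sup>2\<close> edges, while every
  layout passes a balanced cut, which has at least about \<open>(1/4 - \<eta>) p n\<^sup>2\<close> edges.\<close>

section \<open>Cuts and initial segments of layouts\<close>

definition cut_pairs :: "'a set \<Rightarrow> 'a set \<Rightarrow> 'a set set" where
  "cut_pairs V S = (\<lambda>(u, v). {u, v}) ` (S \<times> (V - S))"

lemma card_cut_pairs:
  assumes "S \<subseteq> V" "finite V"
  shows "card (cut_pairs V S) = card S * (card V - card S)"
proof -
  have "inj_on (\<lambda>(u, v). {u, v}) (S \<times> (V - S))"
    by (auto simp: inj_on_def doubleton_eq_iff)
  then have "card (cut_pairs V S) = card (S \<times> (V - S))"
    unfolding cut_pairs_def by (rule card_image)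
  also have "\<dots> = card S * (card V - card S)"
    using assms by (simp add: card_cartesian_product card_Diff_subset finite_subset)
  finally show ?thesis .
qed

text \<open>Cut pairs are potential edges of the complete graph, so they do not depend on the random
  graph. Randomness enters only by intersecting them with the edge set, which makes the cut size
  binomial.\<close>

lemma cut_pairs_subset:
  assumes "S \<subseteq> V"
  shows "cut_pairs V S \<subseteq> {e. e \<subseteq> V \<and> card e = 2}"
  using assms by (auto simp: cut_pairs_def card_2_iff)

text \<open>Since edges stay inside the vertex set, an endpoint with label above \<open>i\<close>
  lies in the complement of the initial segment.\<close>

lemma theta_eq_card_cut:
  assumes "\<And>e. e \<in> edges G \<Longrightarrow> e \<subseteq> verts G"
  shows "theta i \<phi> G = card (edges G \<inter> cut_pairs (verts G) {v \<in> verts G. \<phi> v \<le> i})"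
proof -
  have "{e \<in> edges G. \<exists>u v. e = {u, v} \<and> \<phi> u \<le> i \<and> i < \<phi> v}
      = edges G \<inter> cut_pairs (verts G) {v \<in> verts G. \<phi> v \<le> i}"
    using assms by (fastforce simp: cut_pairs_def)
  then show ?thesis
    by (simp add: theta_def)
qed

lemma card_layout_initial_segment:
  assumes "\<phi> \<in> layouts G" "i \<le> card (verts G)"
  shows "card {v \<in> verts G. \<phi> v \<le> i} = i"
proof -
  have bij: "bij_betw \<phi> (verts G) {1..card (verts G)}"
    using assms by (simp add: layouts_def)
  then have "\<phi> ` {v \<in> verts G. \<phi> v \<le> i} = {1..i}"
    using assms(2) by (fastforce simp: bij_betw_def)
  moreover have "inj_on \<phi> {v \<in> verts G. \<phi> v \<le> i}"
    using bij by (auto simp: bij_betw_def inj_on_def)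
  ultimately show ?thesis
    by (metis card_atLeastAtMost card_image diff_Suc_1)
qed

lemma finite_layouts:
  assumes "finite (verts G)"
  shows "finite (layouts G)"
proof (rule finite_subset)
  show "layouts G \<subseteq> PiE (verts G) (\<lambda>_. {1..card (verts G)})"
    by (auto simp: layouts_def bij_betw_def PiE_def)
  show "finite (PiE (verts G) (\<lambda>_. {1..card (verts G)}))"
    using assms by (intro finite_PiE) auto
qed

lemma layouts_nonempty:
  assumes "finite (verts G)"
  shows "layouts G \<noteq> {}"
proof -
  obtain h where "bij_betw h (verts G) {1..card (verts G)}"
    using finite_same_card_bij[OF assms, of "{1..card (verts G)}"] by auto
  then have "restrict h (verts G) \<in> layouts G"
    by (simp add: layouts_def bij_betw_def inj_on_def)
  then show ?thesis
    by blast
qed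

section \<open>Cutwidths when all cuts are close to their means\<close>

lemma mult_diff_le_quarter_square:
  assumes "s \<le> (n :: nat)"
  shows "real (s * (n - s)) \<le> (real n)\<^sup>2 / 4"
proof -
  have "0 \<le> (real n - 2 * real s)\<^sup>2"
    by simp
  then show ?thesis
    using assms by (simp add: of_nat_diff power2_eq_square algebra_simps)
qed

lemma half_mult_ge:
  fixes n :: nat
  shows "((real n)\<^sup>2 - 1) / 4 \<le> real (n div 2 * (n - n div 2))"
proof (cases "even n")
  case True
  then obtain k where "n = 2 * k" by blast
  then show ?thesis
    by (simp add: power2_eq_square)
\<comment> \<open>For odd \<open>n\<close> the two sides differ by one and equality holds, which
  explains the \<open>- 1\<close>.\<close>
next
  case False
  then obtain k where k: "n = 2 * k + 1"
    using oddE by blast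
  have "n div 2 = k" "n - n div 2 = k + 1"
    using k by auto
  then show ?thesis
    using k by (simp add: power2_eq_square algebra_simps)
qed

lemma CW_bounds_of_uniform_cuts:
  fixes G :: "'a ugraph" and p t :: real
  assumes fin: "finite (verts G)" and n: "card (verts G) = n" "n \<ge> 2" and p: "p \<ge> 0"
    and E: "\<And>e. e \<in> edges G \<Longrightarrow> e \<subseteq> verts G"
    and cut: "\<And>S. S \<subseteq> verts G \<Longrightarrow>
      \<bar>real (card (edges G \<inter> cut_pairs (verts G) S)) - real (card S * (n - card S)) * p\<bar> < t"
  shows "real (MAXCW G) < (real n)\<^sup>2 / 4 * p + t"
    and "((real n)\<^sup>2 - 1) / 4 * p - t < real (MINCW G)"
proof -
  have theta: "\<bar>real (theta i \<phi> G) - real (i * (n - i)) * p\<bar> < t"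
    if "\<phi> \<in> layouts G" "i \<le> n" for \<phi> i
    using cut[of "{v \<in> verts G. \<phi> v \<le> i}"] card_layout_initial_segment[OF that(1), of i] that(2) n(1)
    by (simp add: theta_eq_card_cut[OF E])
  have CW_less: "real (CW G \<phi>) < (real n)\<^sup>2 / 4 * p + t" if \<phi>: "\<phi> \<in> layouts G" for \<phi>
  proof -
    have "CW G \<phi> \<in> (\<lambda>i. theta i \<phi> G) ` {1..n}"
      unfolding CW_def n(1) using n(2) by (intro Max_in) auto
    then obtain i where i: "i \<le> n" "CW G \<phi> = theta i \<phi> G"
      by auto
    have "real (i * (n - i)) * p \<le> (real n)\<^sup>2 / 4 * p"
      by (intro mult_right_mono mult_diff_le_quarter_square i p)
    then show ?thesis
      using theta[OF \<phi> i(1)] i(2) by linarith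
  qed
  have CW_greater: "((real n)\<^sup>2 - 1) / 4 * p - t < real (CW G \<phi>)" if \<phi>: "\<phi> \<in> layouts G" for \<phi>
  proof -
    \<comment> \<open>As \<open>n \<ge> 2\<close>, the middle position \<open>n div 2\<close> is at
      least 1 and so is among those over which \<open>CW\<close> maximises.\<close>
    have "theta (n div 2) \<phi> G \<le> CW G \<phi>"
      unfolding CW_def n(1) using n(2) by (intro Max_ge) auto
    moreover have "((real n)\<^sup>2 - 1) / 4 * p \<le> real (n div 2 * (n - n div 2)) * p"
      by (intro mult_right_mono half_mult_ge p)
    ultimately show ?thesis
      using theta[OF \<phi>, of "n div 2"] by linarith
  qed
  have "MAXCW G \<in> CW G ` layouts G" "MINCW G \<in> CW G ` layouts G"
    unfolding MAXCW_def MINCW_def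
    using finite_layouts[OF fin] layouts_nonempty[OF fin] by (auto intro!: Max_in Min_in)
  then show "real (MAXCW G) < (real n)\<^sup>2 / 4 * p + t"
    and "((real n)\<^sup>2 - 1) / 4 * p - t < real (MINCW G)"
    using CW_less CW_greater by auto
qed

text \<open>The value of \<eta> solves
  \<open>1 / 4 + \<eta> = (1 + \<delta>) * (1 / 4 - 2 * \<eta>)\<close>. In the lower bound one
  \<eta> pays for the deviation and the other for the parity loss. The conjunct
  \<open>MINCW G \<noteq> 0\<close> excludes the case where division by zero would make the ratio 0
  and the inequality trivial.\<close>

lemma GAPCW_less_of_uniform_cuts:
  fixes G :: "'a ugraph" and p \<delta> :: real
  defines "\<eta> \<equiv> \<delta> / (12 + 8 * \<delta>)"
  assumes fin: "finite (verts G)" and n: "card (verts G) = n" "n \<ge> 2" and p: "p > 0"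
    and \<delta>: "\<delta> > 0" and large: "1 \<le> 4 * \<eta> * (real n)\<^sup>2"
    and E: "\<And>e. e \<in> edges G \<Longrightarrow> e \<subseteq> verts G"
    and cut: "\<And>S. S \<subseteq> verts G \<Longrightarrow>
      \<bar>real (card (edges G \<inter> cut_pairs (verts G) S)) - real (card S * (n - card S)) * p\<bar>
        < \<eta> * p * (real n)\<^sup>2"
  shows "MINCW G \<noteq> 0 \<and> GAPCW G < 1 + \<delta>"
proof -
  define q where "q = p * (real n)\<^sup>2"
  have q: "q > 0"
    using p n by (simp add: q_def)
  note bounds = CW_bounds_of_uniform_cuts[OF fin n less_imp_le[OF p] E cut]
  have upper: "real (MAXCW G) < (1 / 4 + \<eta>) * q"
    using bounds(1) by (simp add: q_def algebra_simps)
  \<comment> \<open>Thus the loss \<open>p / 4\<close> from unequal halves is at most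
    \<open>\<eta> * q\<close>.\<close>
  have "p \<le> 4 * \<eta> * q"
    using mult_left_mono[OF large less_imp_le[OF p]] by (simp add: q_def algebra_simps)
  then have lower: "(1 / 4 - 2 * \<eta>) * q < real (MINCW G)"
    using bounds(2) by (simp add: q_def algebra_simps)
  have \<eta>: "1 / 4 - 2 * \<eta> > 0" "1 / 4 + \<eta> = (1 + \<delta>) * (1 / 4 - 2 * \<eta>)"
    using \<delta> by (simp_all add: \<eta>_def field_simps)
  have pos: "real (MINCW G) > 0"
    using lower \<eta>(1) q by (smt (verit) mult_pos_pos)
  have "real (MAXCW G) < (1 + \<delta>) * ((1 / 4 - 2 * \<eta>) * q)"
    using upper unfolding \<eta>(2) by (simp add: mult.assoc)
  also have "\<dots> < (1 + \<delta>) * real (MINCW G)"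
    using lower \<delta> by simp
  finally show ?thesis
    using pos by (simp add: GAPCW_def field_simps)
qed

section \<open>Concentration of cut sizes in the random graph\<close>

lemma map_pmf_card_Int_erdos_renyi:
  assumes "p \<in> {0..1}" and A: "A \<subseteq> {e. e \<subseteq> {1..n} \<and> card e = 2}"
  shows "map_pmf (\<lambda>G. card (edges G \<inter> A)) (erdos_renyi n p) = binomial_pmf (card A) p"
proof -
  define K where "K = {e. e \<subseteq> {1..n} \<and> card e = 2}"
  have finK: "finite K"
    unfolding K_def by (rule finite_subset[of _ "Pow {1..n}"]) auto
  have AK: "A \<subseteq> K"
    using A by (simp add: K_def)
  then have finA: "finite A"
    using finK by (rule finite_subset)
  have "binomial_pmf (card A) p
      = map_pmf (\<lambda>f. card {x \<in> A. f x}) (Pi_pmf A False (\<lambda>_. bernoulli_pmf p))"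
    using assms finA by (intro binomial_pmf_altdef') auto
  \<comment> \<open>The product measure on \<open>A\<close> is the marginal of the one on
    \<open>K\<close>; resetting coordinates outside \<open>A\<close> to \<open>False\<close> does
    not change the count over \<open>A\<close>.\<close>
  also have "\<dots> = map_pmf (\<lambda>f. card {x \<in> A. f x}) (Pi_pmf K False (\<lambda>_. bernoulli_pmf p))"
    unfolding Pi_pmf_subset[OF finK AK]
    by (simp add: map_pmf_comp cong: conj_cong)
  also have "\<dots> = map_pmf (\<lambda>G. card (edges G \<inter> A)) (erdos_renyi n p)"
  proof -
    have "{x \<in> A. f x} = {e \<in> K. f e} \<inter> A" for f
      using AK by blast
    then show ?thesis
      unfolding erdos_renyi_def Let_def K_def[symmetric] by (simp add: map_pmf_comp)
  qed
  finally show ?thesis by simp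
qed

lemma prob_cut_deviation_le:
  fixes n :: nat and p t :: real
  assumes p: "p \<in> {0..1}" and t: "t > 0" and S: "S \<subseteq> {1..n}"
  shows "measure_pmf.prob (erdos_renyi n p)
      {G. t \<le> \<bar>real (card (edges G \<inter> cut_pairs {1..n} S)) - real (card S * (n - card S)) * p\<bar>}
    \<le> 2 * exp (- 8 * t\<^sup>2 / (real n)\<^sup>2)"
proof -
  define m where "m = card S * (n - card S)"
  have m: "card (cut_pairs {1..n} S) = m"
    using card_cut_pairs[OF S] by (simp add: m_def)
  have "card S \<le> n"
    using card_mono[OF _ S] by simp
  then have m_le: "real m \<le> (real n)\<^sup>2 / 4"
    unfolding m_def by (rule mult_diff_le_quarter_square)
  have "measure_pmf.prob (erdos_renyi n p)
      {G. t \<le> \<bar>real (card (edges G \<inter> cut_pairs {1..n} S)) - real m * p\<bar>}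
    = measure_pmf.prob (map_pmf (\<lambda>G. card (edges G \<inter> cut_pairs {1..n} S)) (erdos_renyi n p))
        {x. t \<le> \<bar>real x - real m * p\<bar>}"
    by simp
  also have "\<dots> = measure_pmf.prob (binomial_pmf m p) {x. t \<le> \<bar>real x - real m * p\<bar>}"
    using map_pmf_card_Int_erdos_renyi[OF p cut_pairs_subset[OF S]] m by simp
  also have "\<dots> \<le> 2 * exp (- 8 * t\<^sup>2 / (real n)\<^sup>2)"
  proof (cases "m = 0")
    \<comment> \<open>One side of the cut is empty: the count is surely 0, so it cannot deviate by
      \<open>t > 0\<close>. The comparison of exponents below divides by \<open>m\<close> and needs
      it positive.\<close>
    case True
    then show ?thesis
      using t p by (simp add: binomial_pmf_0 indicator_def)
  next
    case False
    interpret binomial_distribution m p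
      by unfold_locales (rule p)
    have "measure_pmf.prob (binomial_pmf m p) {x. t \<le> \<bar>real x - real m * p\<bar>}
        \<le> 2 * exp (- 2 * t\<^sup>2 / real m)"
      using prob_abs_ge[of t] False t by simp
    \<comment> \<open>Replacing \<open>m\<close> by its maximal value
      \<open>(real n)\<^sup>2 / 4\<close> makes the bound uniform over all cuts.\<close>
    also have "\<dots> \<le> 2 * exp (- 8 * t\<^sup>2 / (real n)\<^sup>2)"
    proof -
      have "2 * t\<^sup>2 / ((real n)\<^sup>2 / 4) \<le> 2 * t\<^sup>2 / real m"
        using m_le False by (intro divide_left_mono mult_pos_pos) (auto intro!: Nat.gr0I)
      then show ?thesis
        by simp
    qed
    finally show ?thesis .
  qed
  finally show ?thesis
    by (simp add: m_def)
qed

text \<open>The union bound runs over vertex sets rather than layouts, since layouts share initial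
  segments; each cut is counted twice, through \<open>S\<close> and its complement.\<close>

lemma prob_some_cut_deviation_le:
  fixes n :: nat and p t :: real
  assumes "p \<in> {0..1}" "t > 0"
  shows "measure_pmf.prob (erdos_renyi n p) {G. \<exists>S\<subseteq>{1..n}.
      t \<le> \<bar>real (card (edges G \<inter> cut_pairs {1..n} S)) - real (card S * (n - card S)) * p\<bar>}
    \<le> 2 ^ n * (2 * exp (- 8 * t\<^sup>2 / (real n)\<^sup>2))"
proof -
  define B where "B S = {G :: nat ugraph.
      t \<le> \<bar>real (card (edges G \<inter> cut_pairs {1..n} S)) - real (card S * (n - card S)) * p\<bar>}" for S
  have "measure_pmf.prob (erdos_renyi n p) (\<Union>S\<in>Pow {1..n}. B S)
      \<le> (\<Sum>S\<in>Pow {1..n}. measure_pmf.prob (erdos_renyi n p) (B S))"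
    by (intro measure_UNION_le) auto
  also have "\<dots> \<le> (\<Sum>S\<in>Pow {1..n}. 2 * exp (- 8 * t\<^sup>2 / (real n)\<^sup>2))"
    unfolding B_def by (intro sum_mono prob_cut_deviation_le assms) auto
  also have "\<dots> = 2 ^ n * (2 * exp (- 8 * t\<^sup>2 / (real n)\<^sup>2))"
    by (simp add: card_Pow)
  also have "(\<Union>S\<in>Pow {1..n}. B S) = {G. \<exists>S\<subseteq>{1..n}.
      t \<le> \<bar>real (card (edges G \<inter> cut_pairs {1..n} S)) - real (card S * (n - card S)) * p\<bar>}"
    by (auto simp: B_def)
  finally show ?thesis .
qed

section \<open>Asymptotics and conclusion\<close>

lemma set_pmf_erdos_renyi:
  assumes "G \<in> set_pmf (erdos_renyi n p)"
  shows "verts G = {1..n}" "e \<in> edges G \<Longrightarrow> e \<subseteq> verts G"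
  using assms by (fastforce simp: erdos_renyi_def)+

lemma exp_union_bound_tendsto_0:
  fixes a b :: real
  assumes "a > 0" "b > 1"
  shows "(\<lambda>n. 2 ^ n * (2 * exp (- a * real n powr b))) \<longlonglongrightarrow> 0"
  using assms by real_asymp

theorem theorem1:
  fixes c :: real and p :: "nat \<Rightarrow> real"
  assumes "0 \<le> c" and "c < 1/2"
    and "\<And>n. n \<ge> 1 \<Longrightarrow> p n \<in> {0..1}"
    and "p \<in> \<Omega>(\<lambda>n. real n powr (-c))"
  shows "\<forall>\<epsilon>>0. \<forall>\<delta>>0. \<exists>N. \<forall>n\<ge>N.
    measure_pmf.prob (erdos_renyi n (p n)) {G. MINCW G \<noteq> 0 \<and> GAPCW G < 1 + \<delta>} > 1 - \<epsilon>"
proof (intro allI impI)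
  fix \<epsilon> \<delta> :: real
  assume \<epsilon>: "\<epsilon> > 0" and \<delta>: "\<delta> > 0"
  define \<eta> where "\<eta> = \<delta> / (12 + 8 * \<delta>)"
  have \<eta>: "\<eta> > 0"
    using \<delta> by (simp add: \<eta>_def)
  obtain k where k: "k > 0" and pk: "\<forall>\<^sub>F n in sequentially. k * norm (real n powr (-c)) \<le> norm (p n)"
    using assms(4) by (auto simp: bigomega_def)
  \<comment> \<open>With \<open>t = \<eta> * p n * (real n)\<^sup>2\<close>, the exponent
    \<open>8 * t\<^sup>2 / (real n)\<^sup>2\<close> is at least this one once
    \<open>p n \<ge> k * real n powr (-c)\<close>. The condition \<open>c < 1/2\<close> says exactly
    that the power \<open>2 - 2 * c\<close> exceeds 1, so that it beats the factor
    \<open>2 ^ n\<close>.\<close>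
  have "(\<lambda>n. 2 ^ n * (2 * exp (- (8 * \<eta>\<^sup>2 * k\<^sup>2) * real n powr (2 - 2 * c)))) \<longlonglongrightarrow> 0"
    using \<eta> k assms(2) by (intro exp_union_bound_tendsto_0) auto
  then have small: "\<forall>\<^sub>F n in sequentially.
      2 ^ n * (2 * exp (- (8 * \<eta>\<^sup>2 * k\<^sup>2) * real n powr (2 - 2 * c))) < \<epsilon>"
    by (rule order_tendstoD) (rule \<epsilon>)
  have large: "\<forall>\<^sub>F n in sequentially. 1 \<le> 4 * \<eta> * (real n)\<^sup>2"
    using \<eta> by real_asymp
  have "\<forall>\<^sub>F n in sequentially.
    measure_pmf.prob (erdos_renyi n (p n)) {G. MINCW G \<noteq> 0 \<and> GAPCW G < 1 + \<delta>} > 1 - \<epsilon>"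
    using pk small large eventually_ge_at_top[of 2]
  proof eventually_elim
    case (elim n)
    have p01: "p n \<in> {0..1}"
      using assms(3) elim by simp
    then have p_ge: "p n \<ge> k * real n powr (-c)"
      using elim by simp
    have p_pos: "p n > 0"
      using p_ge k elim by (smt (verit) mult_pos_pos of_nat_0_less_iff powr_gt_zero zero_less_numeral less_le_trans)
    define t where "t = \<eta> * p n * (real n)\<^sup>2"
    have t: "t > 0"
      using \<eta> p_pos elim by (simp add: t_def)
    define Bad where "Bad = {G :: nat ugraph. \<exists>S\<subseteq>{1..n}.
      t \<le> \<bar>real (card (edges G \<inter> cut_pairs {1..n} S)) - real (card S * (n - card S)) * p n\<bar>}"
    have "k\<^sup>2 * real n powr (2 - 2 * c) = (k * real n powr (-c))\<^sup>2 * (real n)\<^sup>2"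
    proof -
      have "real n powr (2 - 2 * c) = real n powr (-c) * real n powr (-c) * real n powr 2"
        unfolding powr_add[symmetric] by (rule arg_cong[where f = "\<lambda>x. real n powr x"]) simp
      also have "real n powr 2 = (real n)\<^sup>2"
        using elim by simp
      finally show ?thesis
        by (simp add: power2_eq_square)
    qed
    also have "\<dots> \<le> (p n)\<^sup>2 * (real n)\<^sup>2"
      using p_ge k by (intro mult_right_mono power_mono) auto
    also have "8 * \<eta>\<^sup>2 * ((p n)\<^sup>2 * (real n)\<^sup>2) = 8 * t\<^sup>2 / (real n)\<^sup>2"
      using elim by (simp add: t_def power2_eq_square)
    finally have exponent: "8 * \<eta>\<^sup>2 * k\<^sup>2 * real n powr (2 - 2 * c) \<le> 8 * t\<^sup>2 / (real n)\<^sup>2"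
      by (simp add: mult_left_mono mult.assoc)
    have "measure_pmf.prob (erdos_renyi n (p n)) Bad \<le> 2 ^ n * (2 * exp (- 8 * t\<^sup>2 / (real n)\<^sup>2))"
      unfolding Bad_def by (rule prob_some_cut_deviation_le[OF p01 t])
    also have "\<dots> \<le> 2 ^ n * (2 * exp (- (8 * \<eta>\<^sup>2 * k\<^sup>2) * real n powr (2 - 2 * c)))"
      using exponent by simp
    also have "\<dots> < \<epsilon>"
      using elim by simp
    finally have "1 - \<epsilon> < 1 - measure_pmf.prob (erdos_renyi n (p n)) Bad"
      by simp
    also have "\<dots> = measure_pmf.prob (erdos_renyi n (p n)) (- Bad)"
      using measure_pmf.prob_compl[of Bad "erdos_renyi n (p n)"] by (simp add: Compl_eq_Diff_UNIV)
    also have "\<dots> \<le> measure_pmf.prob (erdos_renyi n (p n)) {G. MINCW G \<noteq> 0 \<and> GAPCW G < 1 + \<delta>}"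
    \<comment> \<open>The inclusion is needed only almost surely: \<open>- Bad\<close> also contains
      graphs outside the support, whose vertex set need not be \<open>{1..n}\<close>.\<close>
    proof (rule measure_pmf.finite_measure_mono_AE)
      show "AE G in erdos_renyi n (p n). G \<in> - Bad \<longrightarrow> G \<in> {G. MINCW G \<noteq> 0 \<and> GAPCW G < 1 + \<delta>}"
      proof (rule AE_pmfI, intro impI CollectI)
        fix G
        assume G: "G \<in> set_pmf (erdos_renyi n (p n))" "G \<in> - Bad"
        show "MINCW G \<noteq> 0 \<and> GAPCW G < 1 + \<delta>"
        proof (rule GAPCW_less_of_uniform_cuts[where n = n and p = "p n"])
          show "\<bar>real (card (edges G \<inter> cut_pairs (verts G) S)) - real (card S * (n - card S)) * p n\<bar>
            < \<delta> / (12 + 8 * \<delta>) * p n * (real n)\<^sup>2" if "S \<subseteq> verts G" for S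
            using G(2) that unfolding Bad_def set_pmf_erdos_renyi(1)[OF G(1)] t_def \<eta>_def
            by (auto simp: not_le)
        qed (use set_pmf_erdos_renyi[OF G(1)] elim \<delta> p_pos in \<open>auto simp: \<eta>_def\<close>)
      qed
    qed simp
    finally show ?case .
  qed
  then show "\<exists>N. \<forall>n\<ge>N.
    measure_pmf.prob (erdos_renyi n (p n)) {G. MINCW G \<noteq> 0 \<and> GAPCW G < 1 + \<delta>} > 1 - \<epsilon>"
    by (simp add: eventually_sequentially)
qed

end
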